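(* Let $\rho$ be a Minkowski norm in $\mathbb{R}^d$ whose unit ball is a polytope with $k$ facets. If $\mathcal{F}$ is a finite family of convex sets in $\mathbb{R}^d$ such that the intersection of every $kd$ or fewer members of $\mathcal{F}$ has $\rho$-diameter greater than or equal to $1$, then $\bigcap \mathcal{F}$ has $\rho$-diameter greater than or equal to $1$. Moreover, this statement is not true if $kd$ is replaced by $kd-1$; that is, there is a finite family $\mathcal{F}$ of convex sets in $\mathbb{R}^d$ such that the intersection of every $kd-1$ or fewer members of $\mathcal{F}$ has $\rho$-diameter greater than or equal to $1$, but $\bigcap\mathcal{F}$ has $\rho$-diameter less than $1$.
   Context: For a compact convex set $K\subseteq\mathbb{R}^d$ with nonempty interior that is symmetric about the origin, the Minkowski norm of $K$ is $\rho_K(x)=\min\{t\ge 0 : x\in tK\}$; its unit ball is $K$. For a Minkowski norm $\rho$, the $\rho$-diameter of a set $A$ is $\sup_{x,y\in A}\rho(x-y)$. *)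

theory Defs
  imports "HOL-Analysis.Analysis"
begin

definition symmetric_convex_body :: "(real ^ 'd) set \<Rightarrow> bool" where
  "symmetric_convex_body K \<longleftrightarrow>
     compact K \<and> convex K \<and> interior K \<noteq> {} \<and> (\<forall>x\<in>K. - x \<in> K)"

definition minkowski_norm_of :: "(real ^ 'd) set \<Rightarrow> real ^ 'd \<Rightarrow> real" where
  "minkowski_norm_of K x = (LEAST t. 0 \<le> t \<and> x \<in> (\<lambda>y. t *\<^sub>R y) ` K)"

definition minkowski_norm :: "(real ^ 'd \<Rightarrow> real) \<Rightarrow> bool" where
  "minkowski_norm \<rho> \<longleftrightarrow> (\<exists>K. symmetric_convex_body K \<and> \<rho> = minkowski_norm_of K)"

definition unit_ball :: "(real ^ 'd \<Rightarrow> real) \<Rightarrow> (real ^ 'd) set" where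
  "unit_ball \<rho> = {x. \<rho> x \<le> 1}"

text \<open>The diameter is extended-valued, so that unbounded sets have diameter \<open>\<infinity>\<close>;
  the empty set has diameter \<open>0\<close>.\<close>

definition rho_diameter :: "(real ^ 'd \<Rightarrow> real) \<Rightarrow> (real ^ 'd) set \<Rightarrow> ennreal" where
  "rho_diameter \<rho> A = (SUP (x, y)\<in>A \<times> A. ennreal (\<rho> (x - y)))"

text \<open>The minimum in the definition of the norm is attained, and the unit ball of the norm of
  \<open>K\<close> is \<open>K\<close> itself.\<close>

lemma symmetric_convex_body_zero:
  assumes "symmetric_convex_body K"
  shows "0 \<in> interior K"
proof -
  obtain a where a: "a \<in> interior K"
    using assms by (auto simp: symmetric_convex_body_def)
  have c: "convex K" and "- a \<in> K"
    using assms a interior_subset by (auto simp: symmetric_convex_body_def)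
  from mem_interior_convex_shrink[OF c a this(2), of "1/2"]
  have "- a - (1/2) *\<^sub>R (- a - a) \<in> interior K" by simp
  moreover have "- a - (1/2) *\<^sub>R (- a - a) = 0"
    by (simp add: vec_eq_iff)
  ultimately show ?thesis by simp
qed

lemma minkowski_norm_of_attained:
  assumes "symmetric_convex_body K"
  shows "0 \<le> minkowski_norm_of K x \<and> x \<in> (\<lambda>y. minkowski_norm_of K x *\<^sub>R y) ` K"
    and "0 \<le> t \<Longrightarrow> x \<in> (\<lambda>y. t *\<^sub>R y) ` K \<Longrightarrow> minkowski_norm_of K x \<le> t"
proof -
  define P where "P t \<longleftrightarrow> 0 \<le> t \<and> x \<in> (\<lambda>y. t *\<^sub>R y) ` K" for t :: real
  have "\<exists>m. P m \<and> (\<forall>t. P t \<longrightarrow> m \<le> t)"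
  proof (cases "x = 0")
    case True
    have "0 \<in> K"
      using symmetric_convex_body_zero[OF assms] interior_subset by blast
    then have "P 0" using True by (auto simp: P_def image_iff)
    then show ?thesis by (auto simp: P_def)
  next
    case False
    obtain e where e: "e > 0" "cball 0 e \<subseteq> K"
      using symmetric_convex_body_zero[OF assms] by (meson mem_interior_cball)
    obtain B where B: "B > 0" "\<And>y. y \<in> K \<Longrightarrow> norm y \<le> B"
      using assms by (metis symmetric_convex_body_def compact_imp_bounded bounded_pos)
    define l where "l = norm x / B"
    have l: "l > 0" using False B by (simp add: l_def)
    have P_iff: "P t \<longleftrightarrow> l \<le> t \<and> (1 / t) *\<^sub>R x \<in> K" for t
    proof
      assume "P t"
      then obtain y where y: "0 \<le> t" "y \<in> K" "x = t *\<^sub>R y" by (auto simp: P_def)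
      then have "norm x \<le> t * B" using B by (simp add: mult_left_mono)
      then show "l \<le> t \<and> (1 / t) *\<^sub>R x \<in> K"
        using y False B by (auto simp: l_def field_simps)
    next
      assume *: "l \<le> t \<and> (1 / t) *\<^sub>R x \<in> K"
      then have "t > 0" using l by linarith
      then show "P t" using * by (auto simp: P_def image_iff intro!: bexI[of _ "(1 / t) *\<^sub>R x"])
    qed
    have "continuous_on {l..} (\<lambda>t. (1 / t) *\<^sub>R x)"
      using l by (intro continuous_intros) auto
    moreover have "closed K"
      using assms by (simp add: symmetric_convex_body_def compact_imp_closed)
    ultimately have "closed ({l..} \<inter> (\<lambda>t. (1 / t) *\<^sub>R x) -` K)"
      by (intro continuous_closed_preimage) auto
    moreover have "{l..} \<inter> (\<lambda>t. (1 / t) *\<^sub>R x) -` K = Collect P"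
      by (auto simp: P_iff)
    ultimately have cl: "closed (Collect P)" by simp
    have "(1 / (norm x / e)) *\<^sub>R x \<in> cball 0 e" using False e by simp
    then have "(1 / (norm x / e)) *\<^sub>R x \<in> K" using e by blast
    moreover from this have "l \<le> norm x / e"
    proof -
      have "norm ((1 / (norm x / e)) *\<^sub>R x) \<le> B" using B calculation by blast
      then have "e \<le> B" using False e by simp
      then show ?thesis using e by (simp add: l_def divide_left_mono)
    qed
    ultimately have "Collect P \<noteq> {}" by (auto simp: P_iff)
    moreover have bdd: "bdd_below (Collect P)" by (auto simp: P_def)
    ultimately have "Inf (Collect P) \<in> Collect P"
      using cl by (intro closed_contains_Inf)
    then show ?thesis using bdd cInf_lower by (metis mem_Collect_eq)
  qed
  then obtain m where m: "P m" "\<And>t. P t \<Longrightarrow> m \<le> t" by blast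
  then have "minkowski_norm_of K x = m"
    unfolding minkowski_norm_of_def P_def[symmetric] by (rule Least_equality)
  then show "0 \<le> minkowski_norm_of K x \<and> x \<in> (\<lambda>y. minkowski_norm_of K x *\<^sub>R y) ` K"
    and "0 \<le> t \<Longrightarrow> x \<in> (\<lambda>y. t *\<^sub>R y) ` K \<Longrightarrow> minkowski_norm_of K x \<le> t"
    using m by (auto simp: P_def)
qed

lemma unit_ball_minkowski_norm_of:
  assumes "symmetric_convex_body K"
  shows "unit_ball (minkowski_norm_of K) = K"
proof (rule set_eqI)
  fix x
  have z: "0 \<in> K" and c: "convex K"
    using symmetric_convex_body_zero[OF assms] interior_subset assms
    by (auto simp: symmetric_convex_body_def)
  show "x \<in> unit_ball (minkowski_norm_of K) \<longleftrightarrow> x \<in> K"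
  proof
    assume "x \<in> K"
    then show "x \<in> unit_ball (minkowski_norm_of K)"
      using minkowski_norm_of_attained(2)[OF assms, of 1 x] by (simp add: unit_ball_def)
  next
    assume "x \<in> unit_ball (minkowski_norm_of K)"
    then obtain t y where "0 \<le> t" "t \<le> 1" "y \<in> K" "x = t *\<^sub>R y"
      using minkowski_norm_of_attained(1)[OF assms, of x] by (auto simp: unit_ball_def)
    then show "x \<in> K" using convexD[OF c _ z, of y t "1 - t"] by simp
  qed
qed

end

theory Submission
  imports Defs
begin

text \<open>
  Write the unit ball as $\{x.\ a \bullet x \le 1 \mbox{ for all } a \in N\}$, where $N$ is the set
  of facet normals, one for each of the $k$ facets and closed under negation. Then
  $\rho(x) = \max_{a \in N} a \bullet x$, so a set has diameter below $t$ essentially when its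
  width in each direction $a \in N$ is below $t$.

  For a single direction $a$, an intersection of convex sets $A$ has width at least $t$ iff the
  products $A \times A$ have a common point on the hyperplane $a \bullet (x - y) = t$: a pair that
  is too far apart can be pulled together within the convex intersection. This hyperplane has
  dimension $2d - 1$, so Helly's theorem inside it needs only $2d$ sets (\<open>helly_width\<close>). The
  normals $a$ and $-a$ measure the same width, hence $k/2$ directions suffice, and the union of
  $k/2$ subfamilies of size $2d$ has at most $kd$ members (\<open>helly_diameter\<close>).

  For the converse, choose in the relative interior of each facet a point $p_a$, and replace the
  supporting halfspace of the facet by $d$ halfspaces through $p_a$ whose normals are slightly tilted
  from $a$ and average to $a$, so that locally they form a simplicial cone with apex $p_a$
  (\<open>raised_polytope\<close>). The intersection of all $kd$ halfspaces lies in the unit ball, whose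
  diameter is $2$. Dropping any one of them opens the cone at some $p_a$ and lets a point escape beyond
  the hyperplane $a \bullet x = 1$, at distance more than $2$ from the apex $p_{-a}$ on the opposite side.
  Only finitely many halfspaces can be dropped, so there is one $t > 2$ such that this distance is
  always at least $t$, and shrinking everything by the factor $t$ gives the required family
  (\<open>helly_diameter_sharp\<close>).
\<close>

section \<open>Helly's theorem inside a flat\<close>

text \<open>Only the dimension of the flat spanned by \<open>S\<close> enters Radon's theorem, so restricting all sets
  to \<open>S\<close> lowers the Helly number from that of the ambient space; this is where one set per
  direction is saved. The family is indexed because it is applied to the images \<open>A \<times> A\<close> of
  given sets.\<close>

lemma helly_in_convex_set:
  fixes A :: "'i \<Rightarrow> 'a::euclidean_space set"
  assumes "finite I" and "convex S" and "aff_dim S < int n"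
    and "\<And>i. i \<in> I \<Longrightarrow> convex (A i)"
    and "\<And>J. J \<subseteq> I \<Longrightarrow> card J \<le> n \<Longrightarrow> S \<inter> (\<Inter>i\<in>J. A i) \<noteq> {}"
  shows "S \<inter> (\<Inter>i\<in>I. A i) \<noteq> {}"
  using assms(1,4,5)
proof (induction "card I" arbitrary: I rule: less_induct)
  case less
  show ?case
  proof (cases "card I \<le> n")
    case True
    then show ?thesis using less.prems(3) by blast
  next
    case False
    \<comment> \<open>Radon's argument: one point for each index, lying in all sets but possibly that one.\<close>
    have "S \<inter> (\<Inter>j\<in>I - {i}. A j) \<noteq> {}" if "i \<in> I" for i
    proof (rule less.hyps)
      show "card (I - {i}) < card I"
        using less.prems(1) that by (rule card_Diff1_less)
    qed (use less.prems in blast)+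
    then have "\<forall>i\<in>I. \<exists>x. x \<in> S \<inter> (\<Inter>j\<in>I - {i}. A j)" by blast
    then obtain X where X: "\<And>i. i \<in> I \<Longrightarrow> X i \<in> S \<inter> (\<Inter>j\<in>I - {i}. A j)"
      by metis
    show ?thesis
    proof (cases "inj_on X I")
      case False
      then obtain i j where "i \<in> I" "j \<in> I" "i \<noteq> j" "X i = X j"
        unfolding inj_on_def by blast
      with X[of i] X[of j] have "X i \<in> S \<inter> (\<Inter>i\<in>I. A i)"
        by auto
      then show ?thesis by blast
    next
      case True
      have "affine_dependent (X ` I)"
      proof (rule ccontr)
        assume "\<not> affine_dependent (X ` I)"
        moreover have "X ` I \<subseteq> S" using X by blast
        ultimately have "int (card (X ` I)) \<le> aff_dim S + 1"
          by (rule independent_card_le_aff_dim[rotated])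
        then show False
          using \<open>\<not> card I \<le> n\<close> assms(3) card_image[OF True] by linarith
      qed
      then obtain M P z where MP: "M \<inter> P = {}" "M \<union> P = X ` I"
        and z: "z \<in> convex hull M" "z \<in> convex hull P"
        using Radon_partition[of "X ` I"] less.prems(1) by blast
      \<comment> \<open>Only \<open>X j\<close> can lie outside \<open>A j\<close>, and it belongs to at most one side of the partition.\<close>
      have "z \<in> A j" if "j \<in> I" for j
      proof -
        have hull: "convex hull Q \<subseteq> A j" if "Q \<subseteq> X ` I" "X j \<notin> Q" for Q
        proof (rule hull_minimal)
          show "Q \<subseteq> A j"
          proof
            fix x assume "x \<in> Q"
            then obtain i where "i \<in> I" "x = X i" "i \<noteq> j" using \<open>Q \<subseteq> X ` I\<close> \<open>X j \<notin> Q\<close> by blast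
            with X[of i] \<open>j \<in> I\<close> show "x \<in> A j" by auto
          qed
        qed (rule less.prems(2)[OF \<open>j \<in> I\<close>])
        show ?thesis
        proof (cases "X j \<in> M")
          case True
          then have "P \<subseteq> X ` I" "X j \<notin> P" using MP by auto
          from hull[OF this] z(2) show ?thesis by (rule subsetD)
        next
          case False
          then have "M \<subseteq> X ` I" "X j \<notin> M" using MP by auto
          from hull[OF this] z(1) show ?thesis by (rule subsetD)
        qed
      qed
      moreover have "X ` I \<subseteq> S" using X by blast
      then have "M \<subseteq> S" using MP(2) by (metis Un_subset_iff)
      then have "convex hull M \<subseteq> S"
        using assms(2) by (rule hull_minimal)
      then have "z \<in> S" using z(1) by (rule subsetD)
      ultimately show ?thesis by blast
    qed
  qed
qed

text \<open>Pairs of points at signed distance exactly \<open>t\<close> in direction \<open>a\<close> form a hyperplane \<open>S\<close> of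
  the product space. Asking for equality instead of \<open>\<ge> t\<close> loses nothing by convexity and
  brings the Helly number down from \<open>2 * DIM('a) + 1\<close> to \<open>2 * DIM('a)\<close>.\<close>

lemma helly_width:
  fixes \<F> :: "'a::euclidean_space set set"
  assumes "finite \<F>" and "\<And>A. A \<in> \<F> \<Longrightarrow> convex A" and "a \<noteq> 0" and "t > 0"
    and narrow: "\<forall>x\<in>\<Inter>\<F>. \<forall>y\<in>\<Inter>\<F>. a \<bullet> (x - y) < t"
  shows "\<exists>\<G>\<subseteq>\<F>. card \<G> \<le> 2 * DIM('a) \<and> (\<forall>x\<in>\<Inter>\<G>. \<forall>y\<in>\<Inter>\<G>. a \<bullet> (x - y) < t)"
proof -
  define S where "S = {z. (a, - a) \<bullet> z = t}"
  have S: "(x, y) \<in> S \<longleftrightarrow> a \<bullet> (x - y) = t" for x y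
    by (simp add: S_def inner_diff_right)
  have empty: "S \<inter> (\<Inter>A\<in>\<F>. A \<times> A) = {}"
  proof (intro equals0I)
    fix z assume z: "z \<in> S \<inter> (\<Inter>A\<in>\<F>. A \<times> A)"
    obtain x y where "z = (x, y)" by (cases z)
    with z have "x \<in> \<Inter>\<F>" "y \<in> \<Inter>\<F>" "a \<bullet> (x - y) = t" by (auto simp: S)
    with bspec[OF bspec[OF narrow]] show False by (metis less_irrefl)
  qed
  have dimS: "aff_dim S < int (2 * DIM('a))"
    using \<open>a \<noteq> 0\<close> DIM_positive[where 'a='a]
    by (simp add: S_def zero_prod_def of_nat_diff Suc_le_eq)
  have convS: "convex S"
    unfolding S_def by (rule convex_hyperplane)
  obtain \<G> where G: "\<G> \<subseteq> \<F>" "card \<G> \<le> 2 * DIM('a)" "S \<inter> (\<Inter>A\<in>\<G>. A \<times> A) = {}"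
  proof -
    have "\<not> (\<forall>\<G>\<subseteq>\<F>. card \<G> \<le> 2 * DIM('a) \<longrightarrow> S \<inter> (\<Inter>A\<in>\<G>. A \<times> A) \<noteq> {})"
    proof
      assume *: "\<forall>\<G>\<subseteq>\<F>. card \<G> \<le> 2 * DIM('a) \<longrightarrow> S \<inter> (\<Inter>A\<in>\<G>. A \<times> A) \<noteq> {}"
      have "S \<inter> (\<Inter>A\<in>\<F>. A \<times> A) \<noteq> {}"
      proof (rule helly_in_convex_set[OF assms(1) convS dimS])
        show "convex (A \<times> A)" if "A \<in> \<F>" for A
          using assms(2)[OF that] by (simp add: convex_Times)
      qed (use * in simp)
      with empty show False by simp
    qed
    then show thesis using that by blast
  qed
  have conv: "convex (\<Inter>\<G>)"
    using G(1) assms(2) by (intro convex_Inter) blast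
  have "a \<bullet> (x - y) < t" if xy: "x \<in> \<Inter>\<G>" "y \<in> \<Inter>\<G>" for x y
  proof (rule ccontr)
    \<comment> \<open>Move \<open>x\<close> towards \<open>y\<close> until the pair lies on the hyperplane.\<close>
    define s where "s = t / (a \<bullet> (x - y))"
    assume "\<not> a \<bullet> (x - y) < t"
    then have s: "0 \<le> s" "s \<le> 1" "s * (a \<bullet> (x - y)) = t"
      using \<open>t > 0\<close> by (auto simp: s_def)
    define w where "w = (1 - s) *\<^sub>R y + s *\<^sub>R x"
    have "w \<in> \<Inter>\<G>"
      unfolding w_def using conv xy s by (intro convexD) auto
    moreover have "w - y = s *\<^sub>R (x - y)"
      by (simp add: w_def algebra_simps)
    then have "a \<bullet> (w - y) = t" using s by simp
    ultimately have "(w, y) \<in> S \<inter> (\<Inter>A\<in>\<G>. A \<times> A)"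
      using xy by (auto simp: S)
    with G(3) show False by blast
  qed
  with G(1,2) show ?thesis by (intro exI[of _ \<G>] conjI ballI) simp_all
qed

section \<open>Facet normals\<close>

text \<open>Outer normals scaled to take the value \<open>1\<close> on their facet, which is possible when the origin
  is interior. Facets enter through their dimension, so that membership is visibly invariant under
  negation for symmetric \<open>K\<close>.\<close>

definition facet_normals :: "'a::euclidean_space set \<Rightarrow> 'a set" where
  "facet_normals K =
     {a. (\<forall>x\<in>K. a \<bullet> x \<le> 1) \<and> aff_dim (K \<inter> {x. a \<bullet> x = 1}) = int DIM('a) - 1}"

text \<open>Adding the origin to a set \<open>C\<close> of codimension one on which \<open>a\<close> is constantly \<open>1\<close> gives a set of
  full dimension, and \<open>a - b\<close> vanishes on it.\<close>

lemma normal_unique: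
  fixes a b :: "'a::euclidean_space"
  assumes "aff_dim C = int DIM('a) - 1"
    and "\<And>x. x \<in> C \<Longrightarrow> a \<bullet> x = 1" and "\<And>x. x \<in> C \<Longrightarrow> b \<bullet> x = 1"
  shows "a = b"
proof (rule ccontr)
  assume "a \<noteq> b"
  have "affine hull C \<subseteq> {x. a \<bullet> x = 1}"
    using assms(2) by (intro hull_minimal affine_hyperplane) auto
  then have "0 \<notin> affine hull C" by auto
  then have dim: "aff_dim (insert 0 C) = int DIM('a)"
    using assms(1) by (simp add: aff_dim_insert)
  have "insert 0 C \<subseteq> {x. (a - b) \<bullet> x = 0}"
    using assms(2,3) by (auto simp: inner_diff_left)
  then have "aff_dim (insert 0 C) \<le> aff_dim {x. (a - b) \<bullet> x = 0}"
    by (rule aff_dim_subset)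
  also have "\<dots> = int (DIM('a) - 1)"
    using \<open>a \<noteq> b\<close> by (intro aff_dim_hyperplane) simp
  also have "\<dots> < int DIM('a)"
    using DIM_positive[where 'a='a] by simp
  finally show False using dim by simp
qed

lemma facet_normals_nonzero: "a \<in> facet_normals K \<Longrightarrow> a \<noteq> 0"
  by (auto simp: facet_normals_def)

text \<open>This is what turns the number of facets into the number of normals. Facets of a polytope are
  exposed, and an exposing hyperplane misses the interior point \<open>0\<close>, so it can be normalised to level
  \<open>1\<close>.\<close>

lemma facet_normals_bij_betw:
  fixes K :: "'a::euclidean_space set"
  assumes "polytope K" and zero: "0 \<in> interior K"
  shows "bij_betw (\<lambda>a. K \<inter> {x. a \<bullet> x = 1}) (facet_normals K) {C. C facet_of K}"
  unfolding bij_betw_def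
proof (intro conjI set_eqI iffI)
  show "inj_on (\<lambda>a. K \<inter> {x. a \<bullet> x = 1}) (facet_normals K)"
  proof (rule inj_onI)
    fix a b assume "a \<in> facet_normals K" "b \<in> facet_normals K"
      and "K \<inter> {x. a \<bullet> x = 1} = K \<inter> {x. b \<bullet> x = 1}"
    then show "a = b"
      by (intro normal_unique[of "K \<inter> {x. a \<bullet> x = 1}"]) (auto simp: facet_normals_def)
  qed
next
  have dimK: "aff_dim K = int DIM('a)"
    using zero aff_dim_nonempty_interior by auto
  fix C
  {
    assume "C \<in> (\<lambda>a. K \<inter> {x. a \<bullet> x = 1}) ` facet_normals K"
    then obtain a where a: "a \<in> facet_normals K" "C = K \<inter> {x. a \<bullet> x = 1}" by blast
    then have "C face_of K"
      using face_of_Int_supporting_hyperplane_le[of K a 1] polytope_imp_convex[OF assms(1)]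
      by (auto simp: facet_normals_def)
    moreover have "aff_dim C = int DIM('a) - 1"
      using a by (simp add: facet_normals_def)
    moreover from this have "C \<noteq> {}"
      using DIM_positive[where 'a='a] by auto
    ultimately show "C \<in> {C. C facet_of K}"
      by (simp add: facet_of_def dimK)
  }
  assume "C \<in> {C. C facet_of K}"
  then have C: "C face_of K" "C \<noteq> {}" "aff_dim C = int DIM('a) - 1"
    by (auto simp: facet_of_def dimK)
  then have "C exposed_face_of K"
    by (simp add: exposed_face_of_polyhedron polytope_imp_polyhedron assms(1))
  moreover have "C \<noteq> K" using C(3) dimK by auto
  ultimately obtain a b where ab: "a \<noteq> 0" "K \<subseteq> {x. a \<bullet> x \<le> b}" "C = K \<inter> {x. a \<bullet> x = b}"
    using C(2) by (auto simp: exposed_face_of)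
  have "interior K \<subseteq> {x. a \<bullet> x < b}"
    using interior_mono[OF ab(2)] ab(1) by simp
  then have "b > 0" using zero by auto
  define c where "c = a /\<^sub>R b"
  have cx: "c \<bullet> x = (a \<bullet> x) / b" for x by (simp add: c_def divide_inverse mult.commute)
  have Cc: "C = K \<inter> {x. c \<bullet> x = 1}"
    using \<open>b > 0\<close> ab(3) by (auto simp: cx)
  have "\<forall>x\<in>K. c \<bullet> x \<le> 1"
    using \<open>b > 0\<close> ab(2) by (auto simp: cx)
  then have "c \<in> facet_normals K"
    using C(3) Cc by (simp add: facet_normals_def)
  then show "C \<in> (\<lambda>a. K \<inter> {x. a \<bullet> x = 1}) ` facet_normals K"
    by (rule rev_image_eqI) (rule Cc)
qed

text \<open>The segment from the interior point \<open>0\<close> to a point outside \<open>K\<close> leaves \<open>K\<close> through a facet,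
  and beyond that point the normal of this facet exceeds \<open>1\<close>.\<close>

lemma mem_iff_facet_normals:
  fixes K :: "'a::euclidean_space set"
  assumes "polytope K" and zero: "0 \<in> interior K"
  shows "x \<in> K \<longleftrightarrow> (\<forall>a\<in>facet_normals K. a \<bullet> x \<le> 1)"
proof
  assume R: "\<forall>a\<in>facet_normals K. a \<bullet> x \<le> 1"
  show "x \<in> K"
  proof (rule ccontr)
    assume "x \<notin> K"
    have cl: "closed K" "bounded K"
      using assms(1) by (auto simp: polytope_imp_closed polytope_imp_bounded)
    have "x \<noteq> 0" using \<open>x \<notin> K\<close> zero interior_subset by blast
    with ray_to_frontier[OF cl(2) zero] obtain d where d: "d > 0" "d *\<^sub>R x \<in> frontier K"
      "\<And>e. 0 \<le> e \<Longrightarrow> e < d \<Longrightarrow> e *\<^sub>R x \<in> interior K"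
      by auto
    have "d \<noteq> 1"
      using d(2) \<open>x \<notin> K\<close> cl frontier_subset_closed by force
    moreover have "\<not> 1 < d"
      using d(3)[of 1] \<open>x \<notin> K\<close> interior_subset by auto
    ultimately have "d < 1" by simp
    have "d *\<^sub>R x \<in> K - rel_interior K"
      using d(2) cl zero rel_interior_nonempty_interior[of K] by (auto simp: frontier_def)
    then obtain C where "C facet_of K" "d *\<^sub>R x \<in> C"
      using rel_boundary_of_polyhedron[OF polytope_imp_polyhedron[OF assms(1)]] by auto
    then obtain a where a: "a \<in> facet_normals K" "a \<bullet> (d *\<^sub>R x) = 1"
      using facet_normals_bij_betw[OF assms] unfolding bij_betw_def by blast
    then have "d * (a \<bullet> x) = 1" by simp
    moreover have "d * (a \<bullet> x) \<le> d * 1"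
      using a(1) R d(1) by (intro mult_left_mono) auto
    ultimately show False using \<open>d < 1\<close> by simp
  qed
qed (auto simp: facet_normals_def)

lemma facet_normals_uminus:
  fixes K :: "'a::euclidean_space set"
  assumes sym: "\<And>x. x \<in> K \<Longrightarrow> - x \<in> K" and "a \<in> facet_normals K"
  shows "- a \<in> facet_normals K"
proof -
  have "K \<inter> {x. - a \<bullet> x = 1} = uminus ` (K \<inter> {x. a \<bullet> x = 1})" (is "?L = ?R")
  proof (intro set_eqI iffI)
    fix x assume "x \<in> ?L"
    then have "- x \<in> K \<inter> {x. a \<bullet> x = 1}" using sym by auto
    then show "x \<in> ?R" by (rule rev_image_eqI) simp
  qed (use sym in auto)
  moreover have "linear (uminus :: 'a \<Rightarrow> 'a)" "inj (uminus :: 'a \<Rightarrow> 'a)"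
    by (auto simp: linear_uminus)
  ultimately have "aff_dim (K \<inter> {x. - a \<bullet> x = 1}) = aff_dim (K \<inter> {x. a \<bullet> x = 1})"
    by (metis aff_dim_injective_linear_image)
  moreover have "- a \<bullet> x \<le> 1" if "x \<in> K" for x
    using sym[OF that] assms(2) by (force simp: facet_normals_def)
  ultimately show ?thesis
    using assms(2) by (simp add: facet_normals_def)
qed

text \<open>Any relative interior point of the facet works: a second facet through it would contain the
  whole first facet, and then both have the same normal.\<close>

lemma facet_normal_private_point:
  fixes K :: "'a::euclidean_space set"
  assumes "convex K" and a: "a \<in> facet_normals K"
  obtains p where "p \<in> K" and "a \<bullet> p = 1"
    and "\<And>b. b \<in> facet_normals K \<Longrightarrow> b \<noteq> a \<Longrightarrow> b \<bullet> p < 1"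
proof -
  define C where "C b = K \<inter> {x. b \<bullet> x = 1}" for b
  have "convex (C a)"
    unfolding C_def by (intro convex_Int assms(1) convex_hyperplane)
  moreover have dim: "aff_dim (C a) = int DIM('a) - 1"
    using a by (simp add: facet_normals_def C_def)
  moreover from this have "C a \<noteq> {}"
    using DIM_positive[where 'a='a] by auto
  ultimately obtain p where p: "p \<in> rel_interior (C a)"
    using rel_interior_eq_empty by blast
  then have pC: "p \<in> C a" using rel_interior_subset by blast
  have "b \<bullet> p < 1" if b: "b \<in> facet_normals K" "b \<noteq> a" for b
  proof (rule ccontr)
    assume "\<not> b \<bullet> p < 1"
    with b pC have "p \<in> C b" by (force simp: C_def facet_normals_def)
    moreover have "C b face_of K"
      using face_of_Int_supporting_hyperplane_le[of K b 1] assms(1) b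
      by (auto simp: facet_normals_def C_def)
    ultimately have "C a \<subseteq> C b"
      using p by (intro subset_of_face_of[of "C b" K]) (auto simp: C_def)
    then have "b = a"
      by (intro normal_unique[OF dim]) (auto simp: C_def)
    with b show False by simp
  qed
  with pC show thesis using that by (auto simp: C_def)
qed

text \<open>The width of a set is the same in the directions \<open>a\<close> and \<open>- a\<close>, so one representative of each
  antipodal pair of normals is enough.\<close>

lemma symmetric_finite_half:
  fixes N :: "'a::real_vector set"
  assumes "finite N" and "0 \<notin> N" and "\<And>a. a \<in> N \<Longrightarrow> - a \<in> N"
  shows "\<exists>M. N = M \<union> uminus ` M \<and> 2 * card M = card N"
  using assms
proof (induction "card N" arbitrary: N rule: less_induct)
  case less
  show ?case
  proof (cases "N = {}")
    case False
    then obtain a where a: "a \<in> N" by blast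
    define N' where "N' = N - {a, - a}"
    have a': "- a \<in> N" "a \<noteq> - a"
      using a less.prems by (auto simp: eq_neg_iff_add_eq_0 simp flip: scaleR_2)
    have N: "N = insert a (insert (- a) N')" "a \<notin> N'" "- a \<notin> N'" "finite N'"
      using a a' less.prems(1) by (auto simp: N'_def)
    then have cN: "card N = card N' + 2" using a'(2) by simp
    have "- b \<in> N'" if "b \<in> N'" for b
      using that less.prems(3)[of b] by (auto simp: N'_def minus_equation_iff)
    then obtain M where M: "N' = M \<union> uminus ` M" "2 * card M = card N'"
      using less.hyps[of N'] cN N(4) N'_def less.prems(2) by (metis DiffD1 less_add_same_cancel1 zero_less_numeral)
    have "a \<notin> M" "finite M" using M(1) N(2,4) by simp_all
    then have "N = insert a M \<union> uminus ` insert a M \<and> 2 * card (insert a M) = card N"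
      using M N(1) cN by auto
    then show ?thesis by blast
  qed (use exI[of _ "{}"] in auto)
qed

section \<open>Polyhedral norms as support functions\<close>

definition support_function :: "'a::euclidean_space set \<Rightarrow> 'a \<Rightarrow> real" where
  "support_function N x = (MAX a\<in>N. a \<bullet> x)"

lemma support_function_iffs:
  assumes "finite N" and "N \<noteq> {}"
  shows "support_function N x \<le> r \<longleftrightarrow> (\<forall>a\<in>N. a \<bullet> x \<le> r)"
    and "support_function N x < r \<longleftrightarrow> (\<forall>a\<in>N. a \<bullet> x < r)"
    and "r \<le> support_function N x \<longleftrightarrow> (\<exists>a\<in>N. r \<le> a \<bullet> x)"
  using assms by (auto simp: support_function_def Max_ge_iff)

text \<open>After this lemma only the finite symmetric set of normals matters, not the polytope. The value
  of the maximum is nonnegative because \<open>N\<close> is symmetric, so after an arbitrarily small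
  enlargement it is an admissible scaling factor for the unit ball.\<close>

lemma minkowski_norm_eq_support_function:
  fixes \<rho> :: "real ^ 'd \<Rightarrow> real"
  assumes "minkowski_norm \<rho>" and "polytope (unit_ball \<rho>)"
  defines "N \<equiv> facet_normals (unit_ball \<rho>)"
  shows "finite N" and "N \<noteq> {}" and "card N = card {C. C facet_of unit_ball \<rho>}"
    and "\<And>a. a \<in> N \<Longrightarrow> - a \<in> N"
    and "\<rho> = support_function N"
proof -
  obtain K where K: "symmetric_convex_body K" "\<rho> = minkowski_norm_of K"
    using assms(1) by (auto simp: minkowski_norm_def)
  have ball: "unit_ball \<rho> = K"
    using unit_ball_minkowski_norm_of[OF K(1)] K(2) by simp
  have poly: "polytope K" and zero: "0 \<in> interior K"
    using assms(2) ball symmetric_convex_body_zero[OF K(1)] by auto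
  note bij = facet_normals_bij_betw[OF poly zero]
  show fin: "finite N"
    using bij_betw_finite[OF bij] finite_polytope_facets[OF poly] by (simp add: N_def ball)
  show "card N = card {C. C facet_of unit_ball \<rho>}"
    using bij_betw_same_card[OF bij] by (simp add: N_def ball)
  note memK = mem_iff_facet_normals[OF poly zero, folded N_def[unfolded ball]]
  show ne: "N \<noteq> {}"
  proof
    assume "N = {}"
    then have "K = UNIV" using memK by auto
    then show False
      using polytope_imp_bounded[OF poly] not_bounded_UNIV by simp
  qed
  show sym: "- a \<in> N" if "a \<in> N" for a
    using K(1) that facet_normals_uminus unfolding N_def ball symmetric_convex_body_def by blast
  show "\<rho> = support_function N"
  proof (rule ext, rule antisym)
    fix x
    define r where "r = support_function N x"
    have r: "a \<bullet> x \<le> r" if "a \<in> N" for a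
      using support_function_iffs(1)[OF fin ne, of x r] that by (simp add: r_def)
    obtain a where "a \<in> N" using ne by blast
    then have "r \<ge> 0"
      using r[of a] r[of "- a"] sym[of a] by auto
    show "\<rho> x \<le> support_function N x"
    \<comment> \<open>Rescaling \<open>x\<close> into the unit ball needs a positive factor, but the maximum is \<open>0\<close> for \<open>x = 0\<close>.\<close>
    proof (rule field_le_epsilon)
      fix e :: real assume "e > 0"
      define s where "s = r + e"
      have "s > 0" using \<open>e > 0\<close> \<open>r \<ge> 0\<close> by (simp add: s_def)
      have "a \<bullet> (x /\<^sub>R s) \<le> 1" if "a \<in> N" for a
        using r[OF that] \<open>e > 0\<close> \<open>s > 0\<close> by (simp add: field_simps s_def)
      then have "x /\<^sub>R s \<in> K" using memK by blast
      moreover have "x = s *\<^sub>R (x /\<^sub>R s)" using \<open>s > 0\<close> by simp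
      ultimately have "x \<in> (\<lambda>y. s *\<^sub>R y) ` K" by blast
      then show "\<rho> x \<le> support_function N x + e"
        using minkowski_norm_of_attained(2)[OF K(1), of s x] \<open>s > 0\<close> by (simp add: K(2) s_def r_def)
    qed
    obtain y where y: "0 \<le> \<rho> x" "y \<in> K" "x = \<rho> x *\<^sub>R y"
      using minkowski_norm_of_attained(1)[OF K(1), of x] by (auto simp: K(2))
    have "a \<bullet> x \<le> \<rho> x" if "a \<in> N" for a
    proof -
      have "\<rho> x * (a \<bullet> y) \<le> \<rho> x * 1"
        using y memK that by (intro mult_left_mono) auto
      then show ?thesis using y(3) by (metis inner_scaleR_right mult.right_neutral)
    qed
    then show "support_function N x \<le> \<rho> x"
      by (simp add: support_function_iffs(1)[OF fin ne])
  qed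
qed

lemma rho_diameter_leI:
  assumes "\<And>x y. x \<in> A \<Longrightarrow> y \<in> A \<Longrightarrow> \<rho> (x - y) \<le> r"
  shows "rho_diameter \<rho> A \<le> ennreal r"
  unfolding rho_diameter_def using assms by (auto intro!: SUP_least ennreal_leI)

lemma rho_diameter_upper:
  assumes "x \<in> A" and "y \<in> A"
  shows "ennreal (\<rho> (x - y)) \<le> rho_diameter \<rho> A"
  unfolding rho_diameter_def using assms by (intro SUP_upper2[of "(x, y)"]) auto

section \<open>The Helly property\<close>

text \<open>If the whole intersection is narrower than some \<open>t < 1\<close> in all directions of \<open>N\<close>, then for each
  antipodal pair of directions some \<open>2 * CARD('d)\<close> members already are, and these subfamilies are
  merged. The uniform bound \<open>t\<close> strictly between the diameter and \<open>1\<close> is essential: widths below \<open>1\<close>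
  could still have supremum \<open>1\<close>.\<close>

lemma helly_diameter:
  fixes N :: "(real ^ 'd) set"
  assumes N: "finite N" "N \<noteq> {}" "0 \<notin> N" "\<And>a. a \<in> N \<Longrightarrow> - a \<in> N"
    and "finite \<F>" and "\<And>A. A \<in> \<F> \<Longrightarrow> convex A"
    and large: "\<And>\<G>. \<G> \<subseteq> \<F> \<Longrightarrow> card \<G> \<le> card N * CARD('d)
                  \<Longrightarrow> rho_diameter (support_function N) (\<Inter>\<G>) \<ge> 1"
  shows "rho_diameter (support_function N) (\<Inter>\<F>) \<ge> 1"
proof (rule ccontr)
  let ?diam = "rho_diameter (support_function N)"
  assume "\<not> 1 \<le> ?diam (\<Inter>\<F>)"
  then obtain e where e: "?diam (\<Inter>\<F>) < e" "e < 1"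
    using dense[of "?diam (\<Inter>\<F>)" 1] by (auto simp: not_le)
  then obtain t where t: "e = ennreal t" "t \<ge> 0"
    by (cases e) auto
  have "t > 0" using e(1) t by (cases "t = 0") auto
  have "t < 1" using e(2) t by simp
  have narrow: "a \<bullet> (x - y) < t" if "x \<in> \<Inter>\<F>" "y \<in> \<Inter>\<F>" "a \<in> N" for x y a
  proof -
    have "ennreal (support_function N (x - y)) < ennreal t"
      using rho_diameter_upper[of x "\<Inter>\<F>" y "support_function N"] that e(1) t
      by (meson le_less_trans)
    then have "support_function N (x - y) < t"
      by (metis ennreal_leI not_le)
    then show ?thesis
      using that(3) by (simp add: support_function_iffs(2)[OF N(1,2)])
  qed
  obtain M where M: "N = M \<union> uminus ` M" "2 * card M = card N"
    using symmetric_finite_half[OF N(1,3,4)] by blast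
  have "\<exists>\<G>. \<G> \<subseteq> \<F> \<and> card \<G> \<le> 2 * CARD('d) \<and> (\<forall>x\<in>\<Inter>\<G>. \<forall>y\<in>\<Inter>\<G>. a \<bullet> (x - y) < t)"
    if "a \<in> M" for a
  proof -
    have "a \<in> N" "a \<noteq> 0" using M(1) N(3) that by auto
    with helly_width[OF assms(5,6), of a t] \<open>t > 0\<close> narrow show ?thesis by simp
  qed
  then obtain G where G: "\<And>a. a \<in> M \<Longrightarrow> G a \<subseteq> \<F>" "\<And>a. a \<in> M \<Longrightarrow> card (G a) \<le> 2 * CARD('d)"
    "\<And>a. a \<in> M \<Longrightarrow> \<forall>x\<in>\<Inter>(G a). \<forall>y\<in>\<Inter>(G a). a \<bullet> (x - y) < t"
    by metis
  define \<G> where "\<G> = (\<Union>a\<in>M. G a)"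
  have "finite M" using M(1) N(1) by simp
  then have "card \<G> \<le> (\<Sum>a\<in>M. card (G a))"
    unfolding \<G>_def by (rule card_UN_le)
  also have "\<dots> \<le> card M * (2 * CARD('d))"
    using sum_bounded_above[of M "\<lambda>a. card (G a)", OF G(2)] by simp
  also have "\<dots> = card N * CARD('d)" using M(2)[symmetric] by simp
  finally have card: "card \<G> \<le> card N * CARD('d)" .
  have "support_function N (x - y) \<le> t" if xy: "x \<in> \<Inter>\<G>" "y \<in> \<Inter>\<G>" for x y
  proof -
    have "a \<bullet> (x - y) \<le> t" if "a \<in> N" for a
    proof -
      from that M(1) consider "a \<in> M" | b where "a = - b" "b \<in> M" by blast
      then show ?thesis
      proof cases
        case 1
        then have "x \<in> \<Inter>(G a)" "y \<in> \<Inter>(G a)" using xy by (auto simp: \<G>_def)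
        with G(3)[OF 1] show ?thesis by (meson less_imp_le)
      next
        case 2
        then have "x \<in> \<Inter>(G b)" "y \<in> \<Inter>(G b)" using xy by (auto simp: \<G>_def)
        with G(3)[OF 2(2)] have "b \<bullet> (y - x) < t" by blast
        then show ?thesis using 2(1) by (simp add: inner_diff_right)
      qed
    qed
    then show ?thesis by (simp add: support_function_iffs(1)[OF N(1,2)])
  qed
  then have "?diam (\<Inter>\<G>) \<le> ennreal t" by (rule rho_diameter_leI)
  moreover have "?diam (\<Inter>\<G>) \<ge> 1"
    using card G(1) by (intro large) (auto simp: \<G>_def)
  ultimately have "1 \<le> ennreal t" by (rule order_trans[rotated])
  then show False using \<open>t < 1\<close> by simp
qed

section \<open>Sharpness\<close>

text \<open>The halfspaces \<open>c j \<bullet> x \<le> 0\<close> cut out a cone inside \<open>a \<bullet> x \<le> 0\<close>, as the normals \<open>c j\<close>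
  average to \<open>a\<close>; the vector \<open>v j\<close> violates \<open>a \<bullet> x \<le> 0\<close> but of the tilted constraints at most the
  one for \<open>j\<close>. After a rotation \<open>a\<close> becomes the constant vector \<open>u\<close>, and tilting towards the
  coordinate axes does it.\<close>

lemma simplicial_cone_near:
  fixes a :: "real ^ 'd"
  assumes "a \<noteq> 0" and "\<epsilon> > 0"
  obtains c v :: "'d \<Rightarrow> real ^ 'd" where "\<And>j. norm (c j - a) < \<epsilon>"
    and "(\<Sum>j\<in>UNIV. c j) = real CARD('d) *\<^sub>R a"
    and "\<And>j. a \<bullet> v j > 0" and "\<And>j l. l \<noteq> j \<Longrightarrow> c l \<bullet> v j \<le> 0"
proof -
  define d where "d = real CARD('d)"
  have "d \<ge> 1" unfolding d_def using zero_less_card_finite[where 'a='d] by linarith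
  define s where "s = norm a / sqrt d"
  have "s > 0" using assms(1) \<open>d \<ge> 1\<close> by (simp add: s_def)
  define u :: "real ^ 'd" where "u = (\<chi> i. s)"
  have "norm u = norm a"
    using \<open>d \<ge> 1\<close> by (simp add: u_def norm_vec_def L2_set_def s_def power_divide sum_nonneg flip: d_def)
  then obtain f :: "real ^ 'd \<Rightarrow> real ^ 'd" where f: "orthogonal_transformation f" "f u = a"
    by (rule orthogonal_transformation_exists)
  have lin: "linear f" and inner: "f x \<bullet> f y = x \<bullet> y" and norm: "norm (f x) = norm x" for x y
    using f(1) by (auto simp: orthogonal_transformation_def norm_eq_sqrt_inner)
  define w :: "'d \<Rightarrow> real ^ 'd" where "w j = axis j (d * s) - u" for j
  define B where "B = d * s + norm u"
  have "B > 0" using \<open>d \<ge> 1\<close> \<open>s > 0\<close> by (simp add: B_def add_pos_nonneg)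
  have B: "norm (w j) \<le> B" for j
    using norm_triangle_ineq4[of "axis j (d * s)" u] \<open>d \<ge> 1\<close> \<open>s > 0\<close>
    by (simp add: w_def B_def norm_eq_sqrt_inner[of "axis j (d * s)"] inner_axis_axis)
  define \<eta> where "\<eta> = \<epsilon> / (2 * B)"
  have "\<eta> > 0" using \<open>B > 0\<close> assms(2) by (simp add: \<eta>_def)
  define c where "c j = f (u + \<eta> *\<^sub>R w j)" for j
  \<comment> \<open>The entries sum to \<open>\<eta>\<close>, so \<open>u \<bullet> v' j = s * \<eta> > 0\<close>; tilting towards another axis adds at
     most \<open>- d * s * \<eta>\<close>, which cancels this gain.\<close>
  define v' :: "'d \<Rightarrow> real ^ 'd" where "v' j = (\<chi> i. if i = j then \<eta> + d - 1 else - 1)" for j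
  have sum_v': "(\<Sum>i\<in>UNIV. v' j $ i) = \<eta>" for j
    by (simp add: v'_def sum.If_cases Compl_eq_Diff_UNIV card_Diff_singleton d_def of_nat_diff Suc_leI)
  have uv: "u \<bullet> v' j = s * \<eta>" for j
    using sum_v'[of j] by (simp add: inner_vec_def u_def flip: sum_distrib_left)
  show thesis
  proof (rule that[of c "\<lambda>j. f (v' j)"])
    fix j
    have "c j - a = f (\<eta> *\<^sub>R w j)"
      by (simp add: c_def f(2)[symmetric] flip: linear_diff[OF lin])
    then have "norm (c j - a) = \<eta> * norm (w j)"
      using \<open>\<eta> > 0\<close> by (simp add: norm)
    also have "\<dots> \<le> \<eta> * B" using B \<open>\<eta> > 0\<close> by (simp add: mult_left_mono)
    also have "\<dots> < \<epsilon>" using \<open>B > 0\<close> assms(2) by (simp add: \<eta>_def)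
    finally show "norm (c j - a) < \<epsilon>" .
    show "a \<bullet> f (v' j) > 0"
      using \<open>s > 0\<close> \<open>\<eta> > 0\<close> by (simp add: inner uv flip: f(2))
    fix l assume "l \<noteq> j"
    then have "axis l (d * s) \<bullet> v' j = - (d * s)"
      by (simp add: inner_axis' v'_def)
    then have "c l \<bullet> f (v' j) = s * \<eta> * (1 - d - \<eta>)"
      by (simp add: c_def inner w_def inner_add_left inner_diff_left uv algebra_simps)
    also have "\<dots> \<le> 0"
      using \<open>s > 0\<close> \<open>\<eta> > 0\<close> \<open>d \<ge> 1\<close> by (intro mult_nonneg_nonpos) auto
    finally show "c l \<bullet> f (v' j) \<le> 0" .
  next
    have "(\<Sum>j\<in>UNIV. axis j (d * s)) = d *\<^sub>R u"
      by (simp add: vec_eq_iff axis_def u_def)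
    then have "(\<Sum>j\<in>UNIV. w j) = 0"
      by (simp add: w_def sum_subtractf d_def sum_constant_scaleR del: sum_constant)
    then have "(\<Sum>j\<in>UNIV. u + \<eta> *\<^sub>R w j) = d *\<^sub>R u"
      by (simp add: sum.distrib d_def sum_constant_scaleR del: sum_constant flip: scaleR_sum_right)
    then have "f (\<Sum>j\<in>UNIV. u + \<eta> *\<^sub>R w j) = d *\<^sub>R a"
      by (simp add: linear_scale[OF lin] f(2))
    then show "(\<Sum>j\<in>UNIV. c j) = real CARD('d) *\<^sub>R a"
      by (simp add: c_def linear_sum[OF lin] d_def)
  qed
qed

text \<open>Two openness arguments fix the scales. The normals at \<open>p a\<close> are tilted so little that the apices of
  all other cones stay strictly inside; and from \<open>p a\<close> one can walk a short way along the direction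
  freed by a dropped halfspace without violating the constraints of any other cone.\<close>

lemma raised_polytope:
  fixes N :: "(real ^ 'd) set" and p :: "real ^ 'd \<Rightarrow> real ^ 'd"
  assumes "finite N" and p: "\<forall>a\<in>N. a \<bullet> p a = 1"
    and below: "\<forall>a\<in>N. \<forall>b\<in>N. b \<noteq> a \<longrightarrow> b \<bullet> p a < 1"
  shows "\<exists>H :: (real ^ 'd) \<times> 'd \<Rightarrow> (real ^ 'd) set. (\<forall>i. convex (H i))
    \<and> (\<forall>a\<in>N. \<forall>i\<in>N \<times> UNIV. p a \<in> H i)
    \<and> (\<forall>a\<in>N. \<forall>x\<in>\<Inter>i\<in>N \<times> UNIV. H i. a \<bullet> x \<le> 1)
    \<and> (\<forall>a\<in>N. \<forall>j. \<exists>x\<in>\<Inter>i\<in>N \<times> UNIV - {(a, j)}. H i. a \<bullet> x > 1)"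
proof -
  have "\<exists>c v. (\<forall>j. \<forall>b\<in>N - {a}. c j \<bullet> p b < c j \<bullet> p a)
      \<and> (\<Sum>j\<in>UNIV. c j) = real CARD('d) *\<^sub>R a
      \<and> (\<forall>j::'d. a \<bullet> v j > 0) \<and> (\<forall>j l. l \<noteq> j \<longrightarrow> c l \<bullet> v j \<le> 0)" if a: "a \<in> N" for a
  proof -
    define U where "U = (\<Inter>b\<in>N - {a}. {c. c \<bullet> p b < c \<bullet> p a})"
    have "open U"
      unfolding U_def using assms(1)
      by (intro open_INT ballI open_Collect_less continuous_intros) auto
    moreover have "a \<in> U"
      using bspec[OF p a] below a by (force simp: U_def)
    ultimately obtain e where e: "e > 0" "ball a e \<subseteq> U"
      by (meson open_contains_ball)
    have "a \<noteq> 0" using bspec[OF p a] by auto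
    from simplicial_cone_near[OF this e(1)] obtain c v :: "'d \<Rightarrow> real ^ 'd"
      where cv: "\<And>j. norm (c j - a) < e"
        "(\<Sum>j\<in>UNIV. c j) = real CARD('d) *\<^sub>R a"
        "\<And>j. a \<bullet> v j > 0" "\<And>j l. l \<noteq> j \<Longrightarrow> c l \<bullet> v j \<le> 0" by blast
    have "c j \<in> U" for j
      using cv(1)[of j] e(2) by (auto simp: dist_norm norm_minus_commute subset_iff)
    then show ?thesis using cv(2-4) unfolding U_def by blast
  qed
  then obtain c v where c: "\<And>a b j. a \<in> N \<Longrightarrow> b \<in> N \<Longrightarrow> b \<noteq> a \<Longrightarrow> c a j \<bullet> p b < c a j \<bullet> p a"
    and sum: "\<And>a. a \<in> N \<Longrightarrow> (\<Sum>j\<in>UNIV. c a j) = real CARD('d) *\<^sub>R a"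
    and v: "\<And>a j. a \<in> N \<Longrightarrow> a \<bullet> v a (j::'d) > 0"
    and cv: "\<And>a j l. a \<in> N \<Longrightarrow> l \<noteq> j \<Longrightarrow> c a l \<bullet> v a j \<le> 0"
    by (metis DiffI singletonD)
  define H where "H = (\<lambda>(a, j). {x. c a j \<bullet> x \<le> c a j \<bullet> p a})"
  show ?thesis
  proof (intro exI[of _ H] conjI allI ballI)
    show "convex (H i)" for i
      by (cases i) (simp add: H_def convex_halfspace_le)
    show "p a \<in> H i" if "a \<in> N" "i \<in> N \<times> UNIV" for a i
      using that c[of "fst i" a "snd i"] by (cases "a = fst i") (auto simp: H_def)
    show "a \<bullet> x \<le> 1" if x: "x \<in> (\<Inter>i\<in>N \<times> UNIV. H i)" and a: "a \<in> N" for x a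
    proof -
      have "(\<Sum>j\<in>UNIV. c a j \<bullet> x) \<le> (\<Sum>j\<in>UNIV. c a j \<bullet> p a)"
        using x a by (intro sum_mono) (auto simp: H_def)
      then have "real CARD('d) * (a \<bullet> x) \<le> real CARD('d) * (a \<bullet> p a)"
        using sum[OF a] by (simp flip: inner_sum_left)
      then show ?thesis using bspec[OF p a] by simp
    qed
    show "\<exists>x\<in>\<Inter>i\<in>N \<times> UNIV - {(a, j)}. H i. a \<bullet> x > 1" if a: "a \<in> N" for a j
    proof -
      define U where "U = (\<Inter>(b, l)\<in>(N - {a}) \<times> UNIV. {x. c b l \<bullet> x < c b l \<bullet> p b})"
      have "open U"
        unfolding U_def using assms(1)
        by (intro open_INT ballI) (auto intro!: open_halfspace_lt)
      moreover have "p a \<in> U"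
        using c a by (auto simp: U_def)
      ultimately obtain e where e: "e > 0" "ball (p a) e \<subseteq> U"
        by (meson open_contains_ball)
      have "v a j \<noteq> 0" using v[OF a, of j] by auto
      define s where "s = e / (2 * norm (v a j))"
      have "s > 0" using e(1) \<open>v a j \<noteq> 0\<close> by (simp add: s_def)
      define x where "x = p a + s *\<^sub>R v a j"
      have "norm (s *\<^sub>R v a j) < e"
        using \<open>v a j \<noteq> 0\<close> e(1) by (simp add: s_def)
      then have xU: "x \<in> U"
        using e(2) by (auto simp: x_def dist_norm subset_iff)
      have memH: "x \<in> H (b, l)" if "b \<in> N" "(b, l) \<noteq> (a, j)" for b l
      proof (cases "b = a")
        case True
        then have "c a l \<bullet> v a j \<le> 0" using cv[OF a] that by auto
        then show ?thesis
          using True \<open>s > 0\<close> by (simp add: H_def x_def inner_add_right mult_nonneg_nonpos)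
      next
        case False
        then show ?thesis
          using INT_D[OF xU[unfolded U_def], of "(b, l)"] that by (simp add: H_def)
      qed
      have "x \<in> (\<Inter>i\<in>N \<times> UNIV - {(a, j)}. H i)"
      proof (rule INT_I)
        fix i assume "i \<in> N \<times> UNIV - {(a, j)}"
        then show "x \<in> H i" using memH[of "fst i" "snd i"] by auto
      qed
      moreover have "a \<bullet> x > 1"
        using bspec[OF p a] v[OF a, of j] \<open>s > 0\<close> by (simp add: x_def inner_add_right)
      ultimately show ?thesis by (rule rev_bexI)
    qed
  qed
qed

text \<open>The tilted halfspaces of \<open>raised_polytope\<close>, shrunk by the least distance \<open>t > 2\<close> over all ways
  to drop one of them. A subfamily with fewer members than there are indices comes from an index set
  that misses some \<open>i\<close>, whether or not different indices give different sets.\<close>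

lemma helly_diameter_sharp:
  fixes N :: "(real ^ 'd) set" and p :: "real ^ 'd \<Rightarrow> real ^ 'd"
  assumes N: "finite N" "N \<noteq> {}" "\<And>a. a \<in> N \<Longrightarrow> - a \<in> N"
    and p: "\<forall>a\<in>N. a \<bullet> p a = 1"
    and below: "\<forall>a\<in>N. \<forall>b\<in>N. b \<noteq> a \<longrightarrow> b \<bullet> p a < 1"
  obtains \<F> :: "(real ^ 'd) set set" where "finite \<F>" and "\<And>A. A \<in> \<F> \<Longrightarrow> convex A"
    and "\<And>\<G>. \<G> \<subseteq> \<F> \<Longrightarrow> card \<G> < card N * CARD('d)
           \<Longrightarrow> rho_diameter (support_function N) (\<Inter>\<G>) \<ge> 1"
    and "rho_diameter (support_function N) (\<Inter>\<F>) < 1"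
proof -
  let ?diam = "rho_diameter (support_function N)"
  define I :: "((real ^ 'd) \<times> 'd) set" where "I = N \<times> UNIV"
  have I: "finite I" "I \<noteq> {}" "card I = card N * CARD('d)"
    using N by (auto simp: I_def card_cartesian_product)
  from raised_polytope[OF N(1) p below, folded I_def]
  obtain H :: "(real ^ 'd) \<times> 'd \<Rightarrow> (real ^ 'd) set" where conv: "\<forall>i. convex (H i)"
    and pH: "\<forall>a\<in>N. \<forall>i\<in>I. p a \<in> H i"
    and inK: "\<forall>a\<in>N. \<forall>x\<in>\<Inter>i\<in>I. H i. a \<bullet> x \<le> 1"
    and escape: "\<forall>a\<in>N. \<forall>j. \<exists>x\<in>\<Inter>i\<in>I - {(a, j)}. H i. a \<bullet> x > 1"
    by (elim exE conjE) (rule that)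
  have "\<exists>x. x \<in> (\<Inter>i'\<in>I - {i}. H i') \<and> fst i \<bullet> x > 1" if "i \<in> I" for i
    proof -
    have "fst i \<in> N" using that by (auto simp: I_def)
    from bspec[OF escape this, THEN spec, of "snd i"] show ?thesis by auto
  qed
  then obtain X where X: "\<And>i. i \<in> I \<Longrightarrow> X i \<in> (\<Inter>i'\<in>I - {i}. H i')"
    and X1: "\<And>i. i \<in> I \<Longrightarrow> fst i \<bullet> X i > 1"
    by metis
  define t where "t = (MIN i\<in>I. fst i \<bullet> X i + 1)"
  have t: "t \<le> fst i \<bullet> X i + 1" if "i \<in> I" for i
    unfolding t_def using I(1) that by simp
  have "t > 2"
    unfolding t_def using I(1,2) X1 by (subst Min_gr_iff) auto
  define h where "h i = (\<lambda>x. t *\<^sub>R x) -` H i" for i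
  have h: "x /\<^sub>R t \<in> h i \<longleftrightarrow> x \<in> H i" for x i
    using \<open>t > 2\<close> by (simp add: h_def)
  show thesis
  proof (rule that[of "h ` I"])
    show "finite (h ` I)" using I(1) by simp
    show "convex A" if "A \<in> h ` I" for A
      using that conv by (auto simp: h_def intro!: convex_linear_vimage)
    have "support_function N (x - y) \<le> 2 / t"
      if xy: "x \<in> \<Inter>(h ` I)" "y \<in> \<Inter>(h ` I)" for x y
    proof -
      have "a \<bullet> (x - y) \<le> 2 / t" if "a \<in> N" for a
      proof -
        have "t *\<^sub>R x \<in> (\<Inter>i\<in>I. H i)" "t *\<^sub>R y \<in> (\<Inter>i\<in>I. H i)"
          using xy by (auto simp: h_def)
        then have "a \<bullet> (t *\<^sub>R x) \<le> 1" "- a \<bullet> (t *\<^sub>R y) \<le> 1"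
          using bspec[OF inK that] bspec[OF inK N(3)[OF that]] by (auto dest: bspec)
        then have "t * (a \<bullet> (x - y)) \<le> 2"
          by (simp add: inner_diff_right right_diff_distrib)
        then show ?thesis using \<open>t > 2\<close> by (simp add: field_simps)
      qed
      then show ?thesis by (simp add: support_function_iffs(1)[OF N(1,2)])
    qed
    then have "?diam (\<Inter>(h ` I)) \<le> ennreal (2 / t)" by (rule rho_diameter_leI)
    also have "\<dots> < 1" using \<open>t > 2\<close> by (simp add: ennreal_less_one_iff)
    finally show "?diam (\<Inter>(h ` I)) < 1" .
    fix \<G> assume G: "\<G> \<subseteq> h ` I" "card \<G> < card N * CARD('d)"
    then obtain J where J: "J \<subseteq> I" "inj_on h J" "\<G> = h ` J"
      by (auto simp: subset_image_inj)
    have "J \<noteq> I" using G(2) J card_image[OF J(2)] I(3) by auto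
    then obtain i where i: "i \<in> I" "i \<notin> J" using J(1) by blast
    define a where "a = fst i"
    have a: "a \<in> N" "- a \<in> N" using i(1) N(3) by (auto simp: a_def I_def)
    have mem: "X i /\<^sub>R t \<in> \<Inter>\<G>" "p (- a) /\<^sub>R t \<in> \<Inter>\<G>"
      using X[OF i(1)] bspec[OF pH a(2)] i(2) J(1) by (auto simp: J(3) h)
    have "t \<le> a \<bullet> X i - a \<bullet> p (- a)"
      using t[OF i(1)] bspec[OF p a(2)] by (simp add: a_def)
    then have "1 \<le> a \<bullet> (X i /\<^sub>R t - p (- a) /\<^sub>R t)"
      using \<open>t > 2\<close> by (simp add: inner_diff_right field_simps)
    then have "1 \<le> support_function N (X i /\<^sub>R t - p (- a) /\<^sub>R t)"
      using a(1) support_function_iffs(3)[OF N(1,2)] by blast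
    then have "1 \<le> ennreal (support_function N (X i /\<^sub>R t - p (- a) /\<^sub>R t))"
      using ennreal_leI by fastforce
    also have "\<dots> \<le> ?diam (\<Inter>\<G>)" using mem by (rule rho_diameter_upper)
    finally show "?diam (\<Inter>\<G>) \<ge> 1" .
  qed
qed

section \<open>The Helly number of the diameter\<close>

theorem theorem1p5:
  fixes \<rho> :: "real ^ 'd \<Rightarrow> real" and k :: nat
  assumes "minkowski_norm \<rho>"
    and "polytope (unit_ball \<rho>)"
    and "card {C. C facet_of unit_ball \<rho>} = k"
  shows "(\<forall>\<F> :: (real ^ 'd) set set.
            finite \<F> \<longrightarrow> (\<forall>A\<in>\<F>. convex A) \<longrightarrow>
            (\<forall>\<G>\<subseteq>\<F>. card \<G> \<le> k * CARD('d) \<longrightarrow> rho_diameter \<rho> (\<Inter>\<G>) \<ge> 1) \<longrightarrow>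
            rho_diameter \<rho> (\<Inter>\<F>) \<ge> 1)
       \<and> (\<exists>\<F> :: (real ^ 'd) set set.
            finite \<F> \<and> (\<forall>A\<in>\<F>. convex A) \<and>
            (\<forall>\<G>\<subseteq>\<F>. card \<G> \<le> k * CARD('d) - 1 \<longrightarrow> rho_diameter \<rho> (\<Inter>\<G>) \<ge> 1) \<and>
            rho_diameter \<rho> (\<Inter>\<F>) < 1)"
proof
  define N where "N = facet_normals (unit_ball \<rho>)"
  note norm = minkowski_norm_eq_support_function[OF assms(1,2), folded N_def, unfolded assms(3)]
  have zero: "0 \<notin> N"
    using facet_normals_nonzero unfolding N_def by blast
  show "\<forall>\<F> :: (real ^ 'd) set set. finite \<F> \<longrightarrow> (\<forall>A\<in>\<F>. convex A) \<longrightarrow>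
      (\<forall>\<G>\<subseteq>\<F>. card \<G> \<le> k * CARD('d) \<longrightarrow> rho_diameter \<rho> (\<Inter>\<G>) \<ge> 1) \<longrightarrow>
      rho_diameter \<rho> (\<Inter>\<F>) \<ge> 1"
    using helly_diameter[OF norm(1,2) zero norm(4), folded norm(5)] norm(3) by simp
  have "\<exists>p. a \<bullet> p = 1 \<and> (\<forall>b\<in>N. b \<noteq> a \<longrightarrow> b \<bullet> p < 1)" if "a \<in> N" for a
    using facet_normal_private_point[OF polytope_imp_convex[OF assms(2)] that[unfolded N_def]]
    unfolding N_def by metis
  then obtain p where p: "\<forall>a\<in>N. a \<bullet> p a = 1"
    "\<forall>a\<in>N. \<forall>b\<in>N. b \<noteq> a \<longrightarrow> b \<bullet> p a < 1"
    by metis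
  obtain \<F> where F: "finite \<F>" "\<And>A. A \<in> \<F> \<Longrightarrow> convex A"
    "\<And>\<G>. \<G> \<subseteq> \<F> \<Longrightarrow> card \<G> < k * CARD('d) \<Longrightarrow> rho_diameter \<rho> (\<Inter>\<G>) \<ge> 1"
    "rho_diameter \<rho> (\<Inter>\<F>) < 1"
    using helly_diameter_sharp[OF norm(1,2,4) p, folded norm(5), unfolded norm(3)] by metis
  \<comment> \<open>There are facets, so truncated subtraction does not spoil the bound \<open>k * CARD('d) - 1\<close>.\<close>
  have "k * CARD('d) > 0"
    using norm(1-3) by (metis card_gt_0_iff nat_0_less_mult_iff zero_less_card_finite)
  then have "card \<G> < k * CARD('d)" if "card \<G> \<le> k * CARD('d) - 1" for \<G> :: "(real ^ 'd) set set"
    using that by linarith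
  with F show "\<exists>\<F> :: (real ^ 'd) set set. finite \<F> \<and> (\<forall>A\<in>\<F>. convex A) \<and>
      (\<forall>\<G>\<subseteq>\<F>. card \<G> \<le> k * CARD('d) - 1 \<longrightarrow> rho_diameter \<rho> (\<Inter>\<G>) \<ge> 1) \<and>
      rho_diameter \<rho> (\<Inter>\<F>) < 1"
    by (intro exI[of _ \<F>]) simp
qed

end
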